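(* For every natural complete nFe-sequence $(\omega_n)_{n\ge 1}$ there exists at least one complex complete nFe-sequence $\tilde\omega:\mathbb{C}\to\mathbb{C}$ whose corresponding natural complete nFe-sequence is $(\omega_n)_{n\ge1}$. Furthermore, for every complex complete nFe-sequence there exists exactly one corresponding natural complete nFe-sequence.
   Context: A sequence $(\omega_n)_{n\ge1}$ of complex numbers, with initial values $\omega_1,\omega_2\in\mathbb{C}$ chosen arbitrarily, is called a natural complete nFe-sequence (negaFibonacci-esque sequence) if $\omega_n=\omega_{n-2}-\omega_{n-1}$ for all natural numbers $n\ge3$. A function $\tilde\omega:\mathbb{C}\to\mathbb{C}$ is called a complex complete nFe-sequence if $\tilde\omega(n)=\tilde\omega(n-2)-\tilde\omega(n-1)$ for all $n\in\mathbb{C}$. A natural complete nFe-sequence $(\omega_n)_{n\ge1}$ is called the corresponding natural complete nFe-sequence of a complex complete nFe-sequence $\tilde\omega$ if $\tilde\omega(n)=\omega_n$ for all natural numbers $n\geq 1$. *)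

theory Defs
  imports Complex_Main "HOL-Library.FuncSet"
begin

text \<open>A sequence indexed by \<open>n \<ge> 1\<close> is an extensional function on \<^term>\<open>{1::nat..}\<close>:
  its value at the index 0, which is not part of the sequence, is fixed to \<^const>\<open>undefined\<close>.
  Equality of such functions is therefore equality of the sequences.\<close>

definition natural_complete_nFe :: "(nat \<Rightarrow> complex) \<Rightarrow> bool" where
  "natural_complete_nFe \<omega> \<longleftrightarrow>
     \<omega> \<in> {1..} \<rightarrow>\<^sub>E UNIV \<and> (\<forall>n\<ge>3. \<omega> n = \<omega> (n - 2) - \<omega> (n - 1))"

definition complex_complete_nFe :: "(complex \<Rightarrow> complex) \<Rightarrow> bool" where
  "complex_complete_nFe w \<longleftrightarrow> (\<forall>z. w z = w (z - 2) - w (z - 1))"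

definition corresponding_natural_nFe :: "(nat \<Rightarrow> complex) \<Rightarrow> (complex \<Rightarrow> complex) \<Rightarrow> bool" where
  "corresponding_natural_nFe \<omega> w \<longleftrightarrow>
     natural_complete_nFe \<omega> \<and> complex_complete_nFe w \<and> (\<forall>n\<ge>1. w (of_nat n) = \<omega> n)"

end

theory Submission
  imports Defs
begin

text \<open>The characteristic equation \<open>r\<^sup>2 = 1 - r\<close> has two distinct nonzero complex roots
  \<open>exp a\<close> and \<open>exp b\<close>. Hence \<open>z \<mapsto> A exp (a z) + B exp (b z)\<close> satisfies the recurrence on
  all of the complex plane, and the coefficients can be chosen to match any two initial values,
  which determine the natural sequence. Conversely, a natural sequence corresponding to a
  complex one can only be its restriction to the positive integers.\<close>

text \<open>Factoring out \<open>exp (a * (z - 2))\<close> reduces the recurrence to the hypothesis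
  on \<open>exp a\<close>. Writing the power as \<open>exp (a * z)\<close> avoids any choice of
  branch.\<close>

lemma complex_complete_nFe_exp:
  assumes "(exp a)\<^sup>2 = 1 - exp a"
  shows "complex_complete_nFe (\<lambda>z. c * exp (a * z))"
  unfolding complex_complete_nFe_def
proof
  fix z
  have shift: "exp (a * z) = exp (a * (z - 2)) * (exp a)\<^sup>2"
    and shift': "exp (a * (z - 1)) = exp (a * (z - 2)) * exp a"
    by (simp_all add: power2_eq_square algebra_simps flip: exp_add)
  show "c * exp (a * z) = c * exp (a * (z - 2)) - c * exp (a * (z - 1))"
    unfolding shift shift' assms by (simp only: right_diff_distrib mult_1_right)
qed

lemma complex_complete_nFe_add:
  assumes "complex_complete_nFe v" "complex_complete_nFe w"
  shows "complex_complete_nFe (\<lambda>z. v z + w z)"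
  unfolding complex_complete_nFe_def
proof
  fix z
  show "v z + w z = v (z - 2) + w (z - 2) - (v (z - 1) + w (z - 1))"
    using assms[unfolded complex_complete_nFe_def, THEN spec, of z] by simp
qed

lemma characteristic_exponents:
  obtains a b :: complex
  where "(exp a)\<^sup>2 = 1 - exp a" "(exp b)\<^sup>2 = 1 - exp b" "exp a \<noteq> exp b"
proof
  \<comment> \<open>The roots are \<open>r\<close> and \<open>- s\<close>, where \<open>s\<close> is
    the golden ratio and \<open>r\<close> its reciprocal; both are positive, so \<open>ln\<close>
    applies.\<close>
  define r s :: real where "r = (sqrt 5 - 1) / 2" and "s = (sqrt 5 + 1) / 2"
  have r: "r > 0" "r\<^sup>2 = 1 - r" and s: "s > 0" "s\<^sup>2 = 1 + s"
    by (auto simp: r_def s_def power2_eq_square field_simps add_pos_pos)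
  \<comment> \<open>The summand \<open>\<i> * of_real pi\<close> contributes the factor -1 that the
    negative root needs.\<close>
  let ?a = "of_real (ln r) :: complex" and ?b = "of_real (ln s) + \<i> * of_real pi"
  have a: "exp ?a = of_real r" and b: "exp ?b = of_real (- s)"
    using r s by (simp_all add: exp_add exp_of_real)
  show "(exp ?a)\<^sup>2 = 1 - exp ?a"
    unfolding a using arg_cong[OF r(2), of complex_of_real] by simp
  show "(exp ?b)\<^sup>2 = 1 - exp ?b"
    unfolding b using arg_cong[OF s(2), of complex_of_real] by simp
  show "exp ?a \<noteq> exp ?b"
    unfolding a b of_real_eq_iff using r(1) s(1) by linarith
qed

lemma complex_complete_nFe_initial_values:
  obtains w where "complex_complete_nFe w" "w 1 = x" "w 2 = y"
proof -
  obtain a b :: complex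
    where ab: "(exp a)\<^sup>2 = 1 - exp a" "(exp b)\<^sup>2 = 1 - exp b" and neq: "exp a \<noteq> exp b"
    by (rule characteristic_exponents)
  \<comment> \<open>Cramer's rule for the values x at 1 and y at 2; the system is solvable because
    the two roots are distinct and nonzero.\<close>
  define A B where "A = (y - exp b * x) / (exp a * (exp a - exp b))"
    and "B = (y - exp a * x) / (exp b * (exp b - exp a))"
  let ?w = "\<lambda>z. A * exp (a * z) + B * exp (b * z)"
  have A: "A * exp a = (y - exp b * x) / (exp a - exp b)"
    and B: "B * exp b = - (y - exp a * x) / (exp a - exp b)"
    using neq by (simp_all add: A_def B_def divide_simps) (simp_all add: algebra_simps)
  show thesis
  proof
    show "complex_complete_nFe ?w"
      by (intro complex_complete_nFe_add complex_complete_nFe_exp ab)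
    show "?w 1 = x"
      using neq by (simp add: A B divide_simps) (simp add: algebra_simps)
    have "?w 2 = (A * exp a) * exp a + (B * exp b) * exp b"
      by (simp add: mult.assoc mult_2_right flip: exp_add)
    also have "\<dots> = y"
      using neq unfolding A B by (simp add: divide_simps) (simp add: algebra_simps)
    finally show "?w 2 = y" .
  qed
qed

text \<open>The bound on \<open>n\<close> keeps truncated subtraction on \<open>nat\<close> in
  agreement with subtraction in the complex numbers.\<close>

lemma complex_complete_nFe_of_nat:
  assumes "complex_complete_nFe w" "n \<ge> 2"
  shows "w (of_nat n) = w (of_nat (n - 2)) - w (of_nat (n - 1))"
  using assms(1)[unfolded complex_complete_nFe_def, THEN spec, of "of_nat n"] assms(2)
  by (simp add: of_nat_diff)

lemma corresponding_natural_nFeI: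
  assumes w: "complex_complete_nFe w" and \<omega>: "natural_complete_nFe \<omega>"
    and init: "w 1 = \<omega> 1" "w 2 = \<omega> 2"
  shows "corresponding_natural_nFe \<omega> w"
proof -
  have "w (of_nat n) = \<omega> n" if "n \<ge> 1" for n
    using that
  proof (induction n rule: less_induct)
    case (less n)
    \<comment> \<open>The recurrence reaches back two steps, so 1 and 2 are base cases; from 3 on,
      \<open>n - 2\<close> is still at least 1.\<close>
    consider "n = 1" | "n = 2" | "n \<ge> 3"
      using less.prems by linarith
    then show ?case
    proof cases
      case 3
      then show ?thesis
        using \<omega> complex_complete_nFe_of_nat[OF w, of n] less.IH[of "n - 2"] less.IH[of "n - 1"]
        by (simp add: natural_complete_nFe_def)
    qed (use init in simp_all)
  qed
  with w \<omega> show ?thesis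
    by (simp add: corresponding_natural_nFe_def)
qed

text \<open>Both sequences agree with \<open>w\<close> from index 1 on, and extensionality settles
  index 0.\<close>

lemma corresponding_natural_nFe_unique:
  assumes "corresponding_natural_nFe \<omega> w" "corresponding_natural_nFe \<omega>' w"
  shows "\<omega> = \<omega>'"
proof (rule PiE_ext)
  show "\<omega> \<in> {1..} \<rightarrow>\<^sub>E UNIV" "\<omega>' \<in> {1..} \<rightarrow>\<^sub>E UNIV"
    using assms by (simp_all add: corresponding_natural_nFe_def natural_complete_nFe_def)
qed (use assms in \<open>metis atLeast_iff corresponding_natural_nFe_def\<close>)

text \<open>For \<open>n \<ge> 3\<close> the recurrence involves only indices at least 1, where
  \<open>restrict\<close> leaves the values unchanged.\<close>

lemma corresponding_natural_nFe_restrict: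
  assumes "complex_complete_nFe w"
  shows "corresponding_natural_nFe (restrict (\<lambda>n. w (of_nat n)) {1..}) w"
  using assms complex_complete_nFe_of_nat[OF assms]
  by (auto simp: corresponding_natural_nFe_def natural_complete_nFe_def)

theorem theorem3p5:
  shows "(\<forall>\<omega>. natural_complete_nFe \<omega> \<longrightarrow>
            (\<exists>w. complex_complete_nFe w \<and> corresponding_natural_nFe \<omega> w)) \<and>
         (\<forall>w. complex_complete_nFe w \<longrightarrow>
            (\<exists>!\<omega>. natural_complete_nFe \<omega> \<and> corresponding_natural_nFe \<omega> w))"
proof (intro conjI allI impI)
  fix \<omega>
  assume \<omega>: "natural_complete_nFe \<omega>"
  obtain w where "complex_complete_nFe w" "w 1 = \<omega> 1" "w 2 = \<omega> 2"
    by (rule complex_complete_nFe_initial_values)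
  with \<omega> show "\<exists>w. complex_complete_nFe w \<and> corresponding_natural_nFe \<omega> w"
    by (blast intro: corresponding_natural_nFeI)
next
  fix w
  assume "complex_complete_nFe w"
  then have "corresponding_natural_nFe (restrict (\<lambda>n. w (of_nat n)) {1..}) w"
    by (rule corresponding_natural_nFe_restrict)
  then show "\<exists>!\<omega>. natural_complete_nFe \<omega> \<and> corresponding_natural_nFe \<omega> w"
    using corresponding_natural_nFe_unique corresponding_natural_nFe_def by blast
qed

end
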